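(* Assume that $f=0$ is an ordinary singularity. Then for every regular parameter $\lambda$ $$\mathcal{L}_0(f)=\mathcal{L}_0(f|\Gamma_{f,\lambda})=\operatorname{ord} f-1.$$
   Context: $\mathbb{C}\{X,Y\}$ is the ring of convergent power series. For a nonzero $f=\sum c_{\alpha\beta}X^\alpha Y^\beta$, $\operatorname{ord} f$ is the minimum of $\alpha+\beta$ with $c_{\alpha\beta}\ne0$, and $\operatorname{in} f$ is the sum of the terms of degree $\operatorname{ord} f$. A singularity $f=0$ means that $f$ is reduced (no multiple irreducible factors up to units) and $2\le\operatorname{ord} f<\infty$. Two series of positive order are transverse if their initial forms have no common zero in $\mathbb{C}^2\setminus\{0\}$. A series is unitangent if its initial form has, up to proportionality, exactly one linear factor. A tangential decomposition of $f$ is a factorization $f=f^{(1)}\cdots f^{(t)}$ into unitangent, pairwise transverse components. $f=0$ is an ordinary singularity if all its tangential components are nonsingular ($\operatorname{ord} f^{(i)}=1$). For $A\subset\mathbb{C}^2$ with $0\in\overline{A\setminus\{0\}}$, $$\mathcal{L}_0(f|A)=\inf\{\theta\ge0:\ \text{there is } c>0 \text{ with } |\operatorname{grad} f(z)|\ge c|z|^\theta \text{ for } z\in A \text{ near } 0\in\mathbb{C}^2\},$$ where $\operatorname{grad} f=(\partial f/\partial X,\partial f/\partial Y)$, and $\mathcal{L}_0(f)=\mathcal{L}_0(f|\mathbb{C}^2)$. A regular parameter is a $\lambda\in\mathbb{C}\{X,Y\}$ with $\operatorname{ord}\lambda=1$. $\Gamma_{f,\lambda}$ is the germ at $0$ of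 the polar curve $\mathbf{J}(\lambda,f)=\frac{\partial\lambda}{\partial X}\frac{\partial f}{\partial Y}-\frac{\partial\lambda}{\partial Y}\frac{\partial f}{\partial X}=0$. *)

theory Defs
  imports "HOL-Analysis.Analysis" "HOL-Computational_Algebra.Computational_Algebra"
begin

unbundle no vec_syntax

text \<open>
  A formal power series \<open>\<Sum> c\<^bsub>\<alpha>\<beta>\<^esub> X\<^sup>\<alpha> Y\<^sup>\<beta>\<close> over the complex numbers is represented in
  \<^typ>\<open>complex fps fps\<close> by \<open>f $ \<alpha> $ \<beta> = c\<^bsub>\<alpha>\<beta>\<^esub>\<close>; thus \<open>X\<close> is the outer variable.
\<close>

definition fps2_convergent :: "complex fps fps \<Rightarrow> bool" where
  "fps2_convergent f \<longleftrightarrow>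
     (\<exists>r>0. (\<lambda>(\<alpha>, \<beta>). norm (f $ \<alpha> $ \<beta>) * r ^ (\<alpha> + \<beta>)) summable_on UNIV)"

lemma fps2_convergent_iff_bound:
  "fps2_convergent f \<longleftrightarrow> (\<exists>C R. 0 \<le> C \<and> 0 < R \<and> (\<forall>\<alpha> \<beta>. norm (f $ \<alpha> $ \<beta>) \<le> C * R ^ (\<alpha> + \<beta>)))"
proof
  assume "fps2_convergent f"
  then obtain r :: real where r: "r > 0"
    and s: "(\<lambda>(\<alpha>, \<beta>). norm (f $ \<alpha> $ \<beta>) * r ^ (\<alpha> + \<beta>)) summable_on UNIV"
    unfolding fps2_convergent_def by blast
  define C where "C = infsum (\<lambda>(\<alpha>, \<beta>). norm (f $ \<alpha> $ \<beta>) * r ^ (\<alpha> + \<beta>)) UNIV"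
  have le: "norm (f $ \<alpha> $ \<beta>) * r ^ (\<alpha> + \<beta>) \<le> C" for \<alpha> \<beta>
  proof -
    have "sum (\<lambda>(\<alpha>, \<beta>). norm (f $ \<alpha> $ \<beta>) * r ^ (\<alpha> + \<beta>)) {(\<alpha>, \<beta>)} \<le> C"
      unfolding C_def by (rule finite_sum_le_infsum[OF s]) (use r in auto)
    then show ?thesis by simp
  qed
  have "0 \<le> C"
    unfolding C_def by (rule infsum_nonneg) (use r in auto)
  moreover have "norm (f $ \<alpha> $ \<beta>) \<le> C * inverse r ^ (\<alpha> + \<beta>)" for \<alpha> \<beta>
    using le[of \<alpha> \<beta>] r by (simp add: power_inverse field_simps)
  ultimately show "\<exists>C R. 0 \<le> C \<and> 0 < R \<and> (\<forall>\<alpha> \<beta>. norm (f $ \<alpha> $ \<beta>) \<le> C * R ^ (\<alpha> + \<beta>))"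
    using r by (intro exI[of _ C] exI[of _ "inverse r"]) simp
next
  assume "\<exists>C R. 0 \<le> C \<and> 0 < R \<and> (\<forall>\<alpha> \<beta>. norm (f $ \<alpha> $ \<beta>) \<le> C * R ^ (\<alpha> + \<beta>))"
  then obtain C R :: real where C: "0 \<le> C" and R: "0 < R"
    and b: "\<And>\<alpha> \<beta>. norm (f $ \<alpha> $ \<beta>) \<le> C * R ^ (\<alpha> + \<beta>)" by blast
  define r where "r = 1 / (2 * R)"
  have r: "r > 0" using R by (simp add: r_def)
  have geo: "(\<lambda>n. (1 / 2 :: real) ^ n) summable_on UNIV"
    by (rule norm_summable_imp_summable_on) (simp add: summable_geometric norm_power)
  have "(\<lambda>p. (1 / 2 :: real) ^ fst p * (1 / 2) ^ snd p) summable_on (SIGMA \<alpha>:UNIV. UNIV)"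
  proof (rule summable_on_SigmaI)
    show "((\<lambda>\<beta>. (1 / 2 :: real) ^ fst (\<alpha>, \<beta>) * (1 / 2) ^ snd (\<alpha>, \<beta>))
             has_sum ((1 / 2) ^ \<alpha> * infsum (\<lambda>\<beta>. (1 / 2) ^ \<beta>) UNIV)) UNIV" for \<alpha> :: nat
      using has_sum_cmult_right[OF has_sum_infsum[OF geo]] by simp
    show "(\<lambda>\<alpha>. (1 / 2 :: real) ^ \<alpha> * infsum (\<lambda>\<beta>. (1 / 2) ^ \<beta>) (UNIV :: nat set)) summable_on UNIV"
      by (rule summable_on_cmult_left[OF geo])
  qed auto
  then have g: "(\<lambda>(\<alpha>, \<beta>). C * ((1 / 2 :: real) ^ \<alpha> * (1 / 2) ^ \<beta>)) summable_on UNIV"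
    using summable_on_cmult_right[where c = C] by (simp add: case_prod_unfold)
  have "(\<lambda>(\<alpha>, \<beta>). norm (f $ \<alpha> $ \<beta>) * r ^ (\<alpha> + \<beta>)) summable_on UNIV"
  proof (rule summable_on_comparison_test[OF g], goal_cases)
    case (1 p)
    obtain \<alpha> \<beta> where p: "p = (\<alpha>, \<beta>)" by (cases p)
    have "norm (f $ \<alpha> $ \<beta>) * r ^ (\<alpha> + \<beta>) \<le> (C * R ^ (\<alpha> + \<beta>)) * r ^ (\<alpha> + \<beta>)"
      using b r by (intro mult_right_mono) auto
    also have "\<dots> = C * (R * r) ^ (\<alpha> + \<beta>)" by (simp add: power_mult_distrib)
    also have "R * r = 1 / 2" using R by (simp add: r_def)
    finally show ?case by (simp add: p power_add)
  qed (use r in auto)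
  with r show "fps2_convergent f" unfolding fps2_convergent_def by blast
qed

lemma fps2_convergentI:
  assumes "\<And>\<alpha> \<beta>. norm (f $ \<alpha> $ \<beta>) \<le> C * R ^ (\<alpha> + \<beta>)" "0 \<le> C" "0 < R"
  shows "fps2_convergent f"
  using assms unfolding fps2_convergent_iff_bound by blast

lemma fps2_convergentE:
  assumes "fps2_convergent f"
  obtains C R where "0 \<le> C" "1 \<le> R" "\<And>\<alpha> \<beta>. norm (f $ \<alpha> $ \<beta>) \<le> C * R ^ (\<alpha> + \<beta>)"
proof -
  obtain C R where CR: "0 \<le> C" "0 < R" and b: "\<And>\<alpha> \<beta>. norm (f $ \<alpha> $ \<beta>) \<le> C * R ^ (\<alpha> + \<beta>)"
    using assms unfolding fps2_convergent_iff_bound by blast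
  have "norm (f $ \<alpha> $ \<beta>) \<le> C * (max 1 R) ^ (\<alpha> + \<beta>)" for \<alpha> \<beta>
    using b[of \<alpha> \<beta>] CR by (elim order_trans) (intro mult_left_mono power_mono, auto)
  with CR(1) show ?thesis by (intro that[of C "max 1 R"]) auto
qed

lemma fps2_convergent_pair:
  assumes "fps2_convergent f" "fps2_convergent g"
  obtains C D R where "0 \<le> C" "0 \<le> D" "1 \<le> R"
    "\<And>\<alpha> \<beta>. norm (f $ \<alpha> $ \<beta>) \<le> C * R ^ (\<alpha> + \<beta>)"
    "\<And>\<alpha> \<beta>. norm (g $ \<alpha> $ \<beta>) \<le> D * R ^ (\<alpha> + \<beta>)"
proof -
  obtain C R where 1: "0 \<le> C" "1 \<le> R" and f: "\<And>\<alpha> \<beta>. norm (f $ \<alpha> $ \<beta>) \<le> C * R ^ (\<alpha> + \<beta>)"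
    using assms(1) by (rule fps2_convergentE) blast
  obtain D S where 2: "0 \<le> D" "1 \<le> S" and g: "\<And>\<alpha> \<beta>. norm (g $ \<alpha> $ \<beta>) \<le> D * S ^ (\<alpha> + \<beta>)"
    using assms(2) by (rule fps2_convergentE) blast
  have "norm (f $ \<alpha> $ \<beta>) \<le> C * (max R S) ^ (\<alpha> + \<beta>)" for \<alpha> \<beta>
    using f[of \<alpha> \<beta>] 1 by (elim order_trans) (intro mult_left_mono power_mono, auto)
  moreover have "norm (g $ \<alpha> $ \<beta>) \<le> D * (max R S) ^ (\<alpha> + \<beta>)" for \<alpha> \<beta>
    using g[of \<alpha> \<beta>] 2 by (elim order_trans) (intro mult_left_mono power_mono, auto)
  ultimately show ?thesis using 1 2 by (intro that[of C D "max R S"]) auto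
qed

lemma fps2_convergent_finite_support:
  assumes "finite {(\<alpha>, \<beta>). f $ \<alpha> $ \<beta> \<noteq> 0}"
  shows "fps2_convergent f"
proof (rule fps2_convergentI)
  let ?S = "{(\<alpha>, \<beta>). f $ \<alpha> $ \<beta> \<noteq> 0}" and ?g = "\<lambda>(\<alpha>, \<beta>). norm (f $ \<alpha> $ \<beta>)"
  show "norm (f $ \<alpha> $ \<beta>) \<le> sum ?g ?S * 1 ^ (\<alpha> + \<beta>)" for \<alpha> \<beta>
  proof (cases "(\<alpha>, \<beta>) \<in> ?S")
    case True
    then show ?thesis using member_le_sum[of "(\<alpha>, \<beta>)" ?S ?g] assms by auto
  qed (auto intro!: sum_nonneg)
  show "0 \<le> sum ?g ?S" by (auto intro!: sum_nonneg)
qed simp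

lemma fps2_convergent_0: "fps2_convergent 0"
  by (rule fps2_convergent_finite_support) simp

lemma fps2_convergent_1: "fps2_convergent 1"
  by (rule fps2_convergent_finite_support, rule finite_subset[of _ "{(0, 0)}"])
     (auto simp: fps_one_nth split: if_splits)

lemma fps2_convergent_uminus: "fps2_convergent f \<Longrightarrow> fps2_convergent (- f)"
  by (simp add: fps2_convergent_def)

lemma fps2_convergent_add:
  assumes "fps2_convergent f" "fps2_convergent g"
  shows "fps2_convergent (f + g)"
proof -
  obtain C D R where "0 \<le> C" "0 \<le> D" "1 \<le> R"
    and f: "\<And>\<alpha> \<beta>. norm (f $ \<alpha> $ \<beta>) \<le> C * R ^ (\<alpha> + \<beta>)"
    and g: "\<And>\<alpha> \<beta>. norm (g $ \<alpha> $ \<beta>) \<le> D * R ^ (\<alpha> + \<beta>)"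
    using assms by (rule fps2_convergent_pair) blast
  moreover have "norm ((f + g) $ \<alpha> $ \<beta>) \<le> (C + D) * R ^ (\<alpha> + \<beta>)" for \<alpha> \<beta>
    using norm_triangle_le[OF add_mono[OF f g]] by (simp add: distrib_right)
  ultimately show ?thesis by (intro fps2_convergentI[of _ "C + D" R]) auto
qed

lemma fps2_convergent_diff:
  "fps2_convergent f \<Longrightarrow> fps2_convergent g \<Longrightarrow> fps2_convergent (f - g)"
  using fps2_convergent_add[of f "- g"] fps2_convergent_uminus[of g] by simp

lemma real_Suc_le_2_power: "real (Suc n) \<le> 2 ^ n"
  by (metis Suc_leI less_exp of_nat_le_iff of_nat_numeral of_nat_power)

lemma fps2_convergent_mult:
  assumes "fps2_convergent f" "fps2_convergent g"
  shows "fps2_convergent (f * g)"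
proof -
  obtain C D R where CDR: "0 \<le> C" "0 \<le> D" "1 \<le> R"
    and f: "\<And>\<alpha> \<beta>. norm (f $ \<alpha> $ \<beta>) \<le> C * R ^ (\<alpha> + \<beta>)"
    and g: "\<And>\<alpha> \<beta>. norm (g $ \<alpha> $ \<beta>) \<le> D * R ^ (\<alpha> + \<beta>)"
    using assms by (rule fps2_convergent_pair) blast
  have "norm ((f * g) $ \<alpha> $ \<beta>) \<le> (C * D) * (2 * R) ^ (\<alpha> + \<beta>)" for \<alpha> \<beta>
  proof -
    have "norm ((f * g) $ \<alpha> $ \<beta>) =
        norm (\<Sum>i=0..\<alpha>. \<Sum>j=0..\<beta>. f $ i $ j * g $ (\<alpha> - i) $ (\<beta> - j))"
      by (simp add: fps_mult_nth fps_sum_nth)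
    also have "\<dots> \<le> (\<Sum>i=0..\<alpha>. \<Sum>j=0..\<beta>. C * D * R ^ (\<alpha> + \<beta>))"
    proof (intro sum_norm_le)
      fix i j assume ij: "i \<in> {0..\<alpha>}" "j \<in> {0..\<beta>}"
      have "norm (f $ i $ j * g $ (\<alpha> - i) $ (\<beta> - j))
          \<le> (C * R ^ (i + j)) * (D * R ^ (\<alpha> - i + (\<beta> - j)))"
        unfolding norm_mult using CDR by (intro mult_mono f g) auto
      also have "\<dots> = C * D * R ^ ((i + j) + (\<alpha> - i + (\<beta> - j)))"
        by (simp add: power_add)
      also have "(i + j) + (\<alpha> - i + (\<beta> - j)) = \<alpha> + \<beta>" using ij by auto
      finally show "norm (f $ i $ j * g $ (\<alpha> - i) $ (\<beta> - j)) \<le> C * D * R ^ (\<alpha> + \<beta>)" .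
    qed
    also have "\<dots> = (real (Suc \<alpha>) * real (Suc \<beta>)) * (C * D * R ^ (\<alpha> + \<beta>))" by simp
    also have "\<dots> \<le> (2 ^ \<alpha> * 2 ^ \<beta>) * (C * D * R ^ (\<alpha> + \<beta>))"
      using CDR by (intro mult_right_mono mult_mono real_Suc_le_2_power) auto
    also have "\<dots> = (C * D) * (2 * R) ^ (\<alpha> + \<beta>)"
      by (simp add: power_add power_mult_distrib)
    finally show ?thesis .
  qed
  with CDR show ?thesis by (intro fps2_convergentI[of _ "C * D" "2 * R"]) auto
qed

definition fps2_deriv_X :: "complex fps fps \<Rightarrow> complex fps fps" where
  "fps2_deriv_X f = fps_deriv f"

definition fps2_deriv_Y :: "complex fps fps \<Rightarrow> complex fps fps" where
  "fps2_deriv_Y f = Abs_fps (\<lambda>\<alpha>. fps_deriv (f $ \<alpha>))"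

lemma fps2_deriv_X_nth: "fps2_deriv_X f $ \<alpha> $ \<beta> = of_nat (Suc \<alpha>) * f $ Suc \<alpha> $ \<beta>"
proof -
  have "fps2_deriv_X f $ \<alpha> = fps_const (of_nat (Suc \<alpha>)) * f $ Suc \<alpha>"
    by (simp add: fps2_deriv_X_def fps_of_nat del: of_nat_Suc)
  then show ?thesis by (simp del: of_nat_Suc)
qed

lemma fps2_deriv_Y_nth: "fps2_deriv_Y f $ \<alpha> $ \<beta> = of_nat (Suc \<beta>) * f $ \<alpha> $ Suc \<beta>"
  by (simp add: fps2_deriv_Y_def)

lemma fps2_convergent_deriv:
  assumes "fps2_convergent f"
  shows "fps2_convergent (fps2_deriv_X f)" "fps2_convergent (fps2_deriv_Y f)"
proof -
  obtain C R where CR: "0 \<le> C" "1 \<le> R"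
    and f: "\<And>\<alpha> \<beta>. norm (f $ \<alpha> $ \<beta>) \<le> C * R ^ (\<alpha> + \<beta>)"
    using assms by (rule fps2_convergentE) blast
  have *: "norm (of_nat (Suc k) * c) \<le> (C * R) * (2 * R) ^ n"
    if "norm c \<le> C * R ^ Suc n" "k \<le> n" for k n and c :: complex
  proof -
    have "norm (of_nat (Suc k) * c) \<le> 2 ^ n * (C * R ^ Suc n)"
      unfolding norm_mult norm_of_nat
      using that CR real_Suc_le_2_power[of n] by (intro mult_mono) auto
    also have "\<dots> = (C * R) * (2 * R) ^ n" by (simp add: power_mult_distrib)
    finally show ?thesis .
  qed
  have "norm (fps2_deriv_X f $ \<alpha> $ \<beta>) \<le> (C * R) * (2 * R) ^ (\<alpha> + \<beta>)" for \<alpha> \<beta>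
    unfolding fps2_deriv_X_nth using f[of "Suc \<alpha>" \<beta>] by (intro *) simp_all
  then show "fps2_convergent (fps2_deriv_X f)"
    using CR by (intro fps2_convergentI[of _ "C * R" "2 * R"]) auto
  have "norm (fps2_deriv_Y f $ \<alpha> $ \<beta>) \<le> (C * R) * (2 * R) ^ (\<alpha> + \<beta>)" for \<alpha> \<beta>
    unfolding fps2_deriv_Y_nth using f[of \<alpha> "Suc \<beta>"] by (intro *) simp_all
  then show "fps2_convergent (fps2_deriv_Y f)"
    using CR by (intro fps2_convergentI[of _ "C * R" "2 * R"]) auto
qed

text \<open>
  The ring of convergent power series in two variables. Making it a type lets \<open>dvd\<close>, \<open>irreducible\<close>
  and so on be the library's notions, taken in this ring rather than in the ring of formal series.
\<close>

typedef conv_series = "{f :: complex fps fps. fps2_convergent f}"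
  morphisms fps2_of Conv_series
  using fps2_convergent_0 by blast

setup_lifting type_definition_conv_series

instantiation conv_series :: idom
begin

lift_definition zero_conv_series :: conv_series is 0 by (rule fps2_convergent_0)
lift_definition one_conv_series :: conv_series is 1 by (rule fps2_convergent_1)
lift_definition uminus_conv_series :: "conv_series \<Rightarrow> conv_series" is uminus
  by (rule fps2_convergent_uminus)
lift_definition plus_conv_series :: "conv_series \<Rightarrow> conv_series \<Rightarrow> conv_series" is "(+)"
  by (rule fps2_convergent_add)
lift_definition minus_conv_series :: "conv_series \<Rightarrow> conv_series \<Rightarrow> conv_series" is "(-)"
  by (rule fps2_convergent_diff)
lift_definition times_conv_series :: "conv_series \<Rightarrow> conv_series \<Rightarrow> conv_series" is "(*)"
  by (rule fps2_convergent_mult)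

instance
  by standard (transfer; simp add: algebra_simps)+

end

lift_definition coeff2 :: "conv_series \<Rightarrow> nat \<Rightarrow> nat \<Rightarrow> complex" is
  "\<lambda>f \<alpha> \<beta>. f $ \<alpha> $ \<beta>" .

lift_definition deriv_X :: "conv_series \<Rightarrow> conv_series" is fps2_deriv_X
  by (rule fps2_convergent_deriv)

lift_definition deriv_Y :: "conv_series \<Rightarrow> conv_series" is fps2_deriv_Y
  by (rule fps2_convergent_deriv)

definition converges_at :: "conv_series \<Rightarrow> complex \<times> complex \<Rightarrow> bool" where
  "converges_at f z \<longleftrightarrow> (\<lambda>(\<alpha>, \<beta>). coeff2 f \<alpha> \<beta> * fst z ^ \<alpha> * snd z ^ \<beta>) summable_on UNIV"

text \<open>
  The sum of the series at a point. It is meaningful wherever \<^const>\<open>converges_at\<close> holds, in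
  particular on a neighbourhood of the origin; elsewhere it is \<open>0\<close> by convention of \<^const>\<open>infsum\<close>.
\<close>

definition eval2 :: "conv_series \<Rightarrow> complex \<times> complex \<Rightarrow> complex" where
  "eval2 f z = (\<Sum>\<^sub>\<infinity>(\<alpha>, \<beta>). coeff2 f \<alpha> \<beta> * fst z ^ \<alpha> * snd z ^ \<beta>)"

text \<open>The order of the zero series is \<open>\<infinity>\<close>, the infimum of the empty set.\<close>

definition order2 :: "conv_series \<Rightarrow> enat" where
  "order2 f = Inf {enat (\<alpha> + \<beta>) | \<alpha> \<beta>. coeff2 f \<alpha> \<beta> \<noteq> 0}"

lift_definition hom_part :: "nat \<Rightarrow> conv_series \<Rightarrow> conv_series" is
  "\<lambda>n f. Abs_fps (\<lambda>\<alpha>. Abs_fps (\<lambda>\<beta>. if \<alpha> + \<beta> = n then f $ \<alpha> $ \<beta> else 0))"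
proof (rule fps2_convergent_finite_support)
  fix n :: nat and f :: "complex fps fps"
  show "finite {(\<alpha>, \<beta>). Abs_fps (\<lambda>\<alpha>. Abs_fps (\<lambda>\<beta>. if \<alpha> + \<beta> = n then f $ \<alpha> $ \<beta> else 0)) $ \<alpha> $ \<beta> \<noteq> 0}"
    by (rule finite_subset[of _ "{..n} \<times> {..n}"]) (auto split: if_splits)
qed

definition initial_form :: "conv_series \<Rightarrow> conv_series" where
  "initial_form f = (case order2 f of enat n \<Rightarrow> hom_part n f | \<infinity> \<Rightarrow> 0)"

lift_definition linear_form :: "complex \<Rightarrow> complex \<Rightarrow> conv_series" is
  "\<lambda>u v. fps_const (fps_const u) * fps_X + fps_const (fps_const v * fps_X)"
  by (rule fps2_convergent_finite_support, rule finite_subset[of _ "{(1, 0), (0, 1)}"])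
     (auto simp: fps_X_def split: if_splits)

definition reduced :: "conv_series \<Rightarrow> bool" where
  "reduced f \<longleftrightarrow> \<not> (\<exists>p. irreducible p \<and> p ^ 2 dvd f)"

definition singularity :: "conv_series \<Rightarrow> bool" where
  "singularity f \<longleftrightarrow> reduced f \<and> 2 \<le> order2 f \<and> order2 f < \<infinity>"

definition transverse :: "conv_series \<Rightarrow> conv_series \<Rightarrow> bool" where
  "transverse f g \<longleftrightarrow> 0 < order2 f \<and> 0 < order2 g \<and>
     \<not> (\<exists>z. z \<noteq> 0 \<and> eval2 (initial_form f) z = 0 \<and> eval2 (initial_form g) z = 0)"

text \<open>
  A linear form divides a homogeneous polynomial in the polynomial ring iff it does so in the ring
  of power series (compare the homogeneous parts), so divisibility can be taken in the latter.
\<close>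

definition linear_factor :: "complex \<Rightarrow> complex \<Rightarrow> conv_series \<Rightarrow> bool" where
  "linear_factor u v h \<longleftrightarrow> (u, v) \<noteq> (0, 0) \<and> linear_form u v dvd h"

definition unitangent :: "conv_series \<Rightarrow> bool" where
  "unitangent f \<longleftrightarrow> (\<exists>u v. linear_factor u v (initial_form f) \<and>
     (\<forall>u' v'. linear_factor u' v' (initial_form f) \<longrightarrow> (\<exists>c. u' = c * u \<and> v' = c * v)))"

definition tangential_decomposition :: "conv_series \<Rightarrow> conv_series list \<Rightarrow> bool" where
  "tangential_decomposition f fs \<longleftrightarrow> f = prod_list fs \<and> (\<forall>g\<in>set fs. unitangent g) \<and>
     (\<forall>i<length fs. \<forall>j<length fs. i \<noteq> j \<longrightarrow> transverse (fs ! i) (fs ! j))"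

text \<open>
  Every singularity has a tangential decomposition, whose components are unique up to order and
  units; hence it does not matter which decomposition is inspected.
\<close>

definition ordinary_singularity :: "conv_series \<Rightarrow> bool" where
  "ordinary_singularity f \<longleftrightarrow> singularity f \<and>
     (\<exists>fs. tangential_decomposition f fs \<and> (\<forall>g\<in>set fs. order2 g = 1))"

definition regular_parameter :: "conv_series \<Rightarrow> bool" where
  "regular_parameter l \<longleftrightarrow> order2 l = 1"

definition grad :: "conv_series \<Rightarrow> complex \<times> complex \<Rightarrow> complex \<times> complex" where
  "grad f z = (eval2 (deriv_X f) z, eval2 (deriv_Y f) z)"

text \<open>
  The infimum of the empty set is \<open>\<infinity>\<close>. Since \<open>0 powr \<theta> = 0\<close> for every \<open>\<theta>\<close>, the inequality is void
  at \<open>z = 0\<close>; this cannot affect the infimum when \<open>0\<close> is an accumulation point of \<open>A\<close>.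
  If \<open>0\<close> is not an accumulation point of \<open>A\<close>, the value is \<open>0\<close>.
\<close>

definition lojasiewicz_exponent :: "conv_series \<Rightarrow> (complex \<times> complex) set \<Rightarrow> ereal" where
  "lojasiewicz_exponent f A = Inf {ereal \<theta> | \<theta>. 0 \<le> \<theta> \<and>
     (\<exists>c>0. \<forall>\<^sub>F z in nhds 0. z \<in> A \<longrightarrow> norm (grad f z) \<ge> c * norm z powr \<theta>)}"

definition jacobian :: "conv_series \<Rightarrow> conv_series \<Rightarrow> conv_series" where
  "jacobian l f = deriv_X l * deriv_Y f - deriv_Y l * deriv_X f"

text \<open>
  A representative of the germ of the polar curve; the exponent above depends only on the germ of
  the set at \<open>0\<close>.
\<close>

definition polar_curve :: "conv_series \<Rightarrow> conv_series \<Rightarrow> (complex \<times> complex) set" where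
  "polar_curve f l = {z. converges_at (jacobian l f) z \<and> eval2 (jacobian l f) z = 0}"

end

theory Submission
  imports Defs "HOL-Complex_Analysis.Conformal_Mappings"
begin

text \<open>
  Let \<open>n = ord f\<close>. For an ordinary singularity the initial form \<open>H\<close> of \<open>f\<close> is a product of \<open>n\<close>
  pairwise non-proportional linear forms. At a point \<open>z \<noteq> 0\<close> with \<open>H z \<noteq> 0\<close> the gradient of \<open>H\<close> is
  nonzero by Euler's relation; if \<open>H z = 0\<close>, exactly one linear factor vanishes at \<open>z\<close> and the
  product rule shows that the gradient is a nonzero multiple of that factor. By homogeneity and
  compactness of the sphere, \<open>|grad f z|\<close> is bounded above and below by multiples of
  \<open>|z|\<^sup>n\<^sup>-\<^sup>1\<close> near \<open>0\<close>, so the exponent along any set accumulating at \<open>0\<close> is \<open>n - 1\<close>. The polar curve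
  accumulates at \<open>0\<close> because zeros of a holomorphic function of two variables are never isolated.
\<close>

section \<open>Coefficients and derivatives of convergent series\<close>

lemma coeff2_eqI: "(\<And>\<alpha> \<beta>. coeff2 f \<alpha> \<beta> = coeff2 g \<alpha> \<beta>) \<Longrightarrow> f = g"
  by transfer (simp add: fps_eq_iff)

lemma coeff2_0 [simp]: "coeff2 0 \<alpha> \<beta> = 0"
  by transfer simp

lemma coeff2_1: "coeff2 1 \<alpha> \<beta> = (if \<alpha> = 0 \<and> \<beta> = 0 then 1 else 0)"
  by transfer (simp add: fps_one_nth)

lemma coeff2_add: "coeff2 (f + g) \<alpha> \<beta> = coeff2 f \<alpha> \<beta> + coeff2 g \<alpha> \<beta>"
  by transfer simp

lemma coeff2_diff: "coeff2 (f - g) \<alpha> \<beta> = coeff2 f \<alpha> \<beta> - coeff2 g \<alpha> \<beta>"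
  by transfer simp

lemma coeff2_mult:
  "coeff2 (f * g) \<alpha> \<beta> = (\<Sum>i\<le>\<alpha>. \<Sum>j\<le>\<beta>. coeff2 f i j * coeff2 g (\<alpha> - i) (\<beta> - j))"
  by transfer (simp add: fps_mult_nth fps_sum_nth atLeast0AtMost)

lemma coeff2_hom_part: "coeff2 (hom_part n f) \<alpha> \<beta> = (if \<alpha> + \<beta> = n then coeff2 f \<alpha> \<beta> else 0)"
  by transfer simp

lemma coeff2_deriv_X: "coeff2 (deriv_X f) \<alpha> \<beta> = of_nat (Suc \<alpha>) * coeff2 f (Suc \<alpha>) \<beta>"
  by transfer (rule fps2_deriv_X_nth)

lemma coeff2_deriv_Y: "coeff2 (deriv_Y f) \<alpha> \<beta> = of_nat (Suc \<beta>) * coeff2 f \<alpha> (Suc \<beta>)"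
  by transfer (rule fps2_deriv_Y_nth)

lemma deriv_X_mult: "deriv_X (f * g) = deriv_X f * g + f * deriv_X g"
  by transfer (simp add: fps2_deriv_X_def algebra_simps)

text \<open>The derivative in Y acts on each inner series, so this is the one-variable product rule
  summed over the Cauchy product in X. The outer variable needs no such argument, since there the
  derivative is \<open>fps_deriv\<close> itself.\<close>

lemma deriv_Y_mult: "deriv_Y (f * g) = deriv_Y f * g + f * deriv_Y g"
proof transfer
  have *: "fps_deriv (sum h A) = (\<Sum>i\<in>A. fps_deriv (h i))" for h :: "nat \<Rightarrow> complex fps" and A
    by (induction A rule: infinite_finite_induct) simp_all
  show "fps2_deriv_Y (f * g) = fps2_deriv_Y f * g + f * fps2_deriv_Y g"
    for f g :: "complex fps fps"
    by (simp add: fps2_deriv_Y_def fps_eq_iff[of _ "_ + _"] fps_mult_nth * sum.distrib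
      del: fps_deriv_nth)
qed

lemma deriv_0 [simp]: "deriv_X 0 = 0" "deriv_Y 0 = 0"
  by (rule coeff2_eqI; simp add: coeff2_deriv_X coeff2_deriv_Y)+

lemma deriv_1 [simp]: "deriv_X 1 = 0" "deriv_Y 1 = 0"
  by (rule coeff2_eqI; simp add: coeff2_deriv_X coeff2_deriv_Y coeff2_1)+

text \<open>Lets the nonvanishing of the gradient of the leading form of \<open>f\<close> be read as
  a statement about the leading parts of the two partial derivatives.\<close>

lemma hom_part_deriv:
  "deriv_X (hom_part (Suc n) f) = hom_part n (deriv_X f)"
  "deriv_Y (hom_part (Suc n) f) = hom_part n (deriv_Y f)"
  by (rule coeff2_eqI; simp add: coeff2_deriv_X coeff2_deriv_Y coeff2_hom_part)+

section \<open>Orders and leading forms of products\<close>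

text \<open>Lower bounds on the order, rather than its value, are propagated below: they remain
  valid when a derivative or remainder is zero and has infinite order.\<close>

lemma le_order2_iff: "enat n \<le> order2 f \<longleftrightarrow> (\<forall>\<alpha> \<beta>. \<alpha> + \<beta> < n \<longrightarrow> coeff2 f \<alpha> \<beta> = 0)"
  unfolding order2_def le_Inf_iff by (force simp: not_less)

lemma coeff2_below_order2: "enat n \<le> order2 f \<Longrightarrow> \<alpha> + \<beta> < n \<Longrightarrow> coeff2 f \<alpha> \<beta> = 0"
  by (simp add: le_order2_iff)

lemma order2_deriv:
  assumes "enat (Suc n) \<le> order2 f"
  shows "enat n \<le> order2 (deriv_X f)" "enat n \<le> order2 (deriv_Y f)"
  using assms by (auto simp: le_order2_iff coeff2_deriv_X coeff2_deriv_Y)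

lemma order2_mult:
  assumes "enat m \<le> order2 f" "enat n \<le> order2 g"
  shows "enat (m + n) \<le> order2 (f * g)"
  unfolding le_order2_iff
proof (intro allI impI)
  fix \<alpha> \<beta> assume less: "\<alpha> + \<beta> < m + n"
  have "coeff2 f i j * coeff2 g (\<alpha> - i) (\<beta> - j) = 0" if "i \<le> \<alpha>" "j \<le> \<beta>" for i j
  proof (cases "i + j < m")
    case False
    with less that have "\<alpha> - i + (\<beta> - j) < n" by linarith
    then show ?thesis using coeff2_below_order2[OF assms(2)] by simp
  qed (simp add: coeff2_below_order2[OF assms(1)])
  then show "coeff2 (f * g) \<alpha> \<beta> = 0" by (auto simp: coeff2_mult intro!: sum.neutral)
qed

text \<open>In total degree \<open>m + n\<close> only the splitting into degrees \<open>m\<close>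
  and \<open>n\<close> survives: a smaller degree on the left kills the factor from
  \<open>f\<close>, a larger one leaves too little degree for \<open>g\<close>.\<close>

lemma hom_part_mult:
  assumes "enat m \<le> order2 f" "enat n \<le> order2 g"
  shows "hom_part (m + n) (f * g) = hom_part m f * hom_part n g"
proof (rule coeff2_eqI)
  fix \<alpha> \<beta>
  show "coeff2 (hom_part (m + n) (f * g)) \<alpha> \<beta> = coeff2 (hom_part m f * hom_part n g) \<alpha> \<beta>"
  proof (cases "\<alpha> + \<beta> = m + n")
    case True
    have "coeff2 f i j * coeff2 g (\<alpha> - i) (\<beta> - j) =
        coeff2 (hom_part m f) i j * coeff2 (hom_part n g) (\<alpha> - i) (\<beta> - j)"
      if "i \<le> \<alpha>" "j \<le> \<beta>" for i j
    proof (cases "i + j" m rule: linorder_cases)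
      case less
      then show ?thesis by (simp add: coeff2_below_order2[OF assms(1)] coeff2_hom_part)
    next
      case equal
      with True that have "\<alpha> - i + (\<beta> - j) = n" by linarith
      with equal show ?thesis by (simp add: coeff2_hom_part)
    next
      case greater
      with True that have "\<alpha> - i + (\<beta> - j) < n" by linarith
      with greater show ?thesis by (simp add: coeff2_below_order2[OF assms(2)] coeff2_hom_part)
    qed
    then show ?thesis
      by (simp add: coeff2_hom_part[of "m + n"] True coeff2_mult)
  next
    case False
    have "coeff2 (hom_part m f) i j * coeff2 (hom_part n g) (\<alpha> - i) (\<beta> - j) = 0"
      if "i \<le> \<alpha>" "j \<le> \<beta>" for i j
      using False that by (auto simp: coeff2_hom_part)
    then show ?thesis
      by (auto simp: coeff2_hom_part[of "m + n"] False coeff2_mult intro!: sum.neutral)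
  qed
qed

lemma order2_prod_list:
  assumes "\<forall>g\<in>set gs. 1 \<le> order2 g"
  shows "enat (length gs) \<le> order2 (prod_list gs)"
  using assms
  by (induction gs) (auto simp: zero_enat_def[symmetric] one_enat_def dest: order2_mult)

lemma hom_part_prod_list:
  assumes "\<forall>g\<in>set gs. 1 \<le> order2 g"
  shows "hom_part (length gs) (prod_list gs) = prod_list (map (hom_part 1) gs)"
  using assms
proof (induction gs)
  case Nil
  show ?case by (rule coeff2_eqI) (auto simp: coeff2_hom_part coeff2_1)
next
  case (Cons g gs)
  then show ?case
    using hom_part_mult[of 1 g "length gs" "prod_list gs"] order2_prod_list[of gs]
    by (simp add: one_enat_def)
qed

section \<open>Evaluation of series at points\<close>

lemma term2_bound:
  assumes "norm z \<le> r"
  shows "norm (coeff2 f \<alpha> \<beta> * fst z ^ \<alpha> * snd z ^ \<beta>) \<le> norm (coeff2 f \<alpha> \<beta>) * r ^ (\<alpha> + \<beta>)"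
proof -
  have r: "0 \<le> r" "norm (fst z) \<le> r" "norm (snd z) \<le> r"
    using assms norm_fst_le[of "fst z" "snd z"] norm_snd_le[of "snd z" "fst z"] order_trans[OF norm_ge_zero assms]
    by auto
  then have "norm (fst z) ^ \<alpha> * norm (snd z) ^ \<beta> \<le> r ^ \<alpha> * r ^ \<beta>"
    by (intro mult_mono power_mono) auto
  then show ?thesis
    by (simp add: norm_mult norm_power power_add mult.assoc mult_left_mono)
qed

text \<open>One such \<open>r\<close> yields a summable majorant on the whole closed ball of radius
  \<open>r\<close>; the estimates, continuity and holomorphy below rest on it.\<close>

lemma conv_series_radius:
  obtains r where "r > 0" "(\<lambda>(\<alpha>, \<beta>). norm (coeff2 f \<alpha> \<beta>) * r ^ (\<alpha> + \<beta>)) summable_on UNIV"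
proof -
  have "\<exists>r>0. (\<lambda>(\<alpha>, \<beta>). norm (coeff2 f \<alpha> \<beta>) * r ^ (\<alpha> + \<beta>)) summable_on UNIV"
    by transfer (simp add: fps2_convergent_def)
  then show ?thesis using that by blast
qed

lemma converges_at_norm_le:
  assumes "(\<lambda>(\<alpha>, \<beta>). norm (coeff2 f \<alpha> \<beta>) * r ^ (\<alpha> + \<beta>)) summable_on UNIV" "norm z \<le> r"
  shows "converges_at f z"
  unfolding converges_at_def summable_on_iff_abs_summable_on_complex
  by (rule summable_on_comparison_test[OF assms(1)])
     (use term2_bound[OF assms(2)] in auto)

lemma has_sum_eval2:
  "converges_at f z \<Longrightarrow>
    ((\<lambda>(\<alpha>, \<beta>). coeff2 f \<alpha> \<beta> * fst z ^ \<alpha> * snd z ^ \<beta>) has_sum eval2 f z) UNIV"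
  unfolding converges_at_def eval2_def by (rule has_sum_infsum)

lemma eval2I:
  assumes "((\<lambda>(\<alpha>, \<beta>). coeff2 f \<alpha> \<beta> * fst z ^ \<alpha> * snd z ^ \<beta>) has_sum s) UNIV"
  shows "converges_at f z" "eval2 f z = s"
  using assms unfolding converges_at_def eval2_def
  by (auto intro: has_sum_imp_summable infsumI)

lemma eval2_0 [simp]: "eval2 0 z = 0"
  by (rule eval2I) (simp add: case_prod_unfold)

lemma eval2_origin: "eval2 f 0 = coeff2 f 0 0"
  by (rule eval2I, rule has_sum_finite_neutralI[of "{(0, 0)}"])
     (auto simp: power_0_left split: if_splits)

lemma
  assumes "converges_at f z" "converges_at g z"
  shows converges_at_add: "converges_at (f + g) z"
    and eval2_add: "eval2 (f + g) z = eval2 f z + eval2 g z"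
proof -
  have "((\<lambda>(\<alpha>, \<beta>). coeff2 (f + g) \<alpha> \<beta> * fst z ^ \<alpha> * snd z ^ \<beta>) has_sum
      eval2 f z + eval2 g z) UNIV"
    using has_sum_add[OF assms[THEN has_sum_eval2]]
    by (simp add: case_prod_unfold coeff2_add algebra_simps)
  then show "converges_at (f + g) z" "eval2 (f + g) z = eval2 f z + eval2 g z"
    by (rule eval2I)+
qed

text \<open>Cauchy product in two indices: the absolutely summable family of products of terms is
  regrouped by the sum of the exponent pairs, and each group is finite.\<close>

lemma
  assumes "converges_at f z" "converges_at g z"
  shows converges_at_mult: "converges_at (f * g) z"
    and eval2_mult: "eval2 (f * g) z = eval2 f z * eval2 g z"
proof -
  define s where "s h p = coeff2 h (fst p) (snd p) * fst z ^ fst p * snd z ^ snd p" for h p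
  have sum: "(s h has_sum eval2 h z) UNIV" "(\<lambda>p. norm (s h p)) summable_on UNIV" if "converges_at h z" for h
  proof -
    show "(s h has_sum eval2 h z) UNIV"
      using has_sum_eval2[OF that] by (simp add: s_def[abs_def] case_prod_unfold)
    \<comment> \<open>For complex families summability is the same as absolute summability.\<close>
    then show "(\<lambda>p. norm (s h p)) summable_on UNIV"
      using has_sum_imp_summable summable_on_iff_abs_summable_on_complex by blast
  qed
  note f = sum[OF assms(1)] and g = sum[OF assms(2)]
  have "(\<lambda>x. norm (case x of (p, q) \<Rightarrow> s f p * s g q)) summable_on UNIV \<times> UNIV"
  proof (rule Infinite_Sum.abs_summable_on_Sigma_iff[THEN iffD2], intro conjI ballI)
    show "(\<lambda>q. norm (case (p, q) of (p, q) \<Rightarrow> s f p * s g q)) summable_on UNIV" for p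
      using summable_on_cmult_right[OF g(2)] by (simp add: norm_mult)
    show "(\<lambda>p. norm (\<Sum>\<^sub>\<infinity>q. norm (case (p, q) of (p, q) \<Rightarrow> s f p * s g q))) summable_on UNIV"
      using summable_on_cmult_left[OF f(2)]
      by (simp add: norm_mult abs_mult infsum_cmult_right')
  qed
  then have summable: "(\<lambda>(p, q). s f p * s g q) summable_on UNIV \<times> UNIV"
    by (rule abs_summable_summable)
  have "((\<lambda>(p, q). s f p * s g q) has_sum eval2 f z * eval2 g z) (UNIV \<times> UNIV)"
    by (rule has_sum_SigmaI[where g = "\<lambda>p. s f p * eval2 g z"])
       (use f g summable in \<open>auto intro!: has_sum_cmult_left has_sum_cmult_right\<close>)
  \<comment> \<open>The new index \<open>p\<close> is the total exponent pair and
    \<open>(i, j)\<close> the share taken from \<open>f\<close>.\<close>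
  also have "?this \<longleftrightarrow> ((\<lambda>(p, i, j). s f (i, j) * s g (fst p - i, snd p - j))
      has_sum eval2 f z * eval2 g z) (SIGMA p:UNIV. {..fst p} \<times> {..snd p})"
    by (rule has_sum_reindex_bij_witness
        [where i = "\<lambda>(p, i, j). ((i, j), (fst p - i, snd p - j))"
           and j = "\<lambda>((i, j), (k, l)). ((i + k, j + l), (i, j))"]) auto
  finally have "((\<lambda>p. \<Sum>(i, j)\<in>{..fst p} \<times> {..snd p}. s f (i, j) * s g (fst p - i, snd p - j))
      has_sum eval2 f z * eval2 g z) UNIV"
    by (rule has_sum_SigmaD) (auto intro!: has_sum_finiteI simp: case_prod_unfold)
  also have "(\<lambda>p. \<Sum>(i, j)\<in>{..fst p} \<times> {..snd p}. s f (i, j) * s g (fst p - i, snd p - j)) = s (f * g)"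
  proof
    fix p :: "nat \<times> nat"
    have "s f (i, j) * s g (fst p - i, snd p - j) =
        coeff2 f i j * coeff2 g (fst p - i) (snd p - j) * (fst z ^ fst p * snd z ^ snd p)"
      if "i \<le> fst p" "j \<le> snd p" for i j
    proof -
      have "fst z ^ fst p = fst z ^ i * fst z ^ (fst p - i)"
        "snd z ^ snd p = snd z ^ j * snd z ^ (snd p - j)"
        using that by (simp_all flip: power_add)
      then show ?thesis by (simp add: s_def)
    qed
    then show "(\<Sum>(i, j)\<in>{..fst p} \<times> {..snd p}. s f (i, j) * s g (fst p - i, snd p - j)) = s (f * g) p"
      by (simp add: s_def[of "f * g"] coeff2_mult sum_distrib_right mult.assoc
          flip: sum.cartesian_product)
  qed
  finally have "((\<lambda>(\<alpha>, \<beta>). coeff2 (f * g) \<alpha> \<beta> * fst z ^ \<alpha> * snd z ^ \<beta>) has_sum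
      eval2 f z * eval2 g z) UNIV"
    by (simp add: s_def[abs_def] case_prod_unfold)
  then show "converges_at (f * g) z" "eval2 (f * g) z = eval2 f z * eval2 g z"
    by (rule eval2I)+
qed

lemma
  shows converges_at_hom_part: "converges_at (hom_part n f) z"
    and eval2_hom_part:
      "eval2 (hom_part n f) z = (\<Sum>\<alpha>\<le>n. coeff2 f \<alpha> (n - \<alpha>) * fst z ^ \<alpha> * snd z ^ (n - \<alpha>))"
proof -
  have "((\<lambda>(\<alpha>, \<beta>). coeff2 (hom_part n f) \<alpha> \<beta> * fst z ^ \<alpha> * snd z ^ \<beta>) has_sum
      (\<Sum>\<alpha>\<le>n. coeff2 f \<alpha> (n - \<alpha>) * fst z ^ \<alpha> * snd z ^ (n - \<alpha>))) UNIV"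
    by (rule has_sum_finite_neutralI[of "(\<lambda>\<alpha>. (\<alpha>, n - \<alpha>)) ` {..n}"])
       (auto simp: coeff2_hom_part sum.reindex inj_on_def image_iff)
  then show "converges_at (hom_part n f) z"
    "eval2 (hom_part n f) z = (\<Sum>\<alpha>\<le>n. coeff2 f \<alpha> (n - \<alpha>) * fst z ^ \<alpha> * snd z ^ (n - \<alpha>))"
    by (rule eval2I)+
qed

lemma eval2_hom_part_scaleR:
  "eval2 (hom_part n f) (t *\<^sub>R z) = t ^ n *\<^sub>R eval2 (hom_part n f) z"
proof -
  have "coeff2 f \<alpha> (n - \<alpha>) * fst (t *\<^sub>R z) ^ \<alpha> * snd (t *\<^sub>R z) ^ (n - \<alpha>) =
      t ^ n *\<^sub>R (coeff2 f \<alpha> (n - \<alpha>) * fst z ^ \<alpha> * snd z ^ (n - \<alpha>))" if "\<alpha> \<le> n" for \<alpha>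
    using power_add[of t \<alpha> "n - \<alpha>"] that by (simp add: scaleR_power mult.commute)
  then show ?thesis unfolding eval2_hom_part scaleR_sum_right by (intro sum.cong) auto
qed

lemma continuous_on_eval2_hom_part: "continuous_on A (eval2 (hom_part n f))"
  unfolding eval2_hom_part[abs_def] by (intro continuous_intros)

section \<open>Growth of series and gradients at the origin\<close>

lemma eventually_norm_le_nhds_0:
  "(r :: real) > 0 \<Longrightarrow> \<forall>\<^sub>F z in nhds (0 :: 'a :: real_normed_vector). norm z \<le> r"
  unfolding eventually_nhds_metric by (auto simp: dist_norm intro: less_imp_le)

lemma eventually_converges_at: "\<forall>\<^sub>F z in nhds 0. converges_at f z"
proof -
  obtain r where r: "r > 0" "(\<lambda>(\<alpha>, \<beta>). norm (coeff2 f \<alpha> \<beta>) * r ^ (\<alpha> + \<beta>)) summable_on UNIV"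
    by (rule conv_series_radius)
  show ?thesis
    using eventually_norm_le_nhds_0[OF r(1)] by eventually_elim (rule converges_at_norm_le[OF r(2)])
qed

text \<open>Every nonzero term has degree at least \<open>m\<close>, so shrinking the radius from
  \<open>r\<close> to \<open>norm z\<close> gains at least the factor
  \<open>(norm z / r) ^ m\<close> over the majorant.\<close>

lemma eval2_bigo:
  assumes "enat m \<le> order2 f"
  obtains C where "\<forall>\<^sub>F z in nhds 0. norm (eval2 f z) \<le> C * norm z ^ m"
proof -
  obtain r where r: "r > 0" "(\<lambda>(\<alpha>, \<beta>). norm (coeff2 f \<alpha> \<beta>) * r ^ (\<alpha> + \<beta>)) summable_on UNIV"
    by (rule conv_series_radius)
  define S where "S = (\<Sum>\<^sub>\<infinity>(\<alpha>, \<beta>). norm (coeff2 f \<alpha> \<beta>) * r ^ (\<alpha> + \<beta>))"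
  have "norm (eval2 f z) \<le> (S / r ^ m) * norm z ^ m" if z: "norm z \<le> r" for z
  proof -
    have "((\<lambda>p. (case p of (\<alpha>, \<beta>) \<Rightarrow> norm (coeff2 f \<alpha> \<beta>) * r ^ (\<alpha> + \<beta>)) * (norm z / r) ^ m)
        has_sum S * (norm z / r) ^ m) UNIV"
      unfolding S_def by (rule has_sum_cmult_left[OF has_sum_infsum[OF r(2)]])
    then have "norm (eval2 f z) \<le> S * (norm z / r) ^ m"
    proof (rule norm_infsum_le[OF has_sum_eval2[OF converges_at_norm_le[OF r(2) z]]])
      fix p :: "nat \<times> nat"
      obtain \<alpha> \<beta> where p: "p = (\<alpha>, \<beta>)" by (cases p)
      show "norm (case p of (\<alpha>, \<beta>) \<Rightarrow> coeff2 f \<alpha> \<beta> * fst z ^ \<alpha> * snd z ^ \<beta>) \<le>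
          (case p of (\<alpha>, \<beta>) \<Rightarrow> norm (coeff2 f \<alpha> \<beta>) * r ^ (\<alpha> + \<beta>)) * (norm z / r) ^ m"
      proof (cases "\<alpha> + \<beta> < m")
        case True
        then show ?thesis using p coeff2_below_order2[OF assms] by simp
      next
        case False
        have "norm z ^ (\<alpha> + \<beta>) = r ^ (\<alpha> + \<beta>) * (norm z / r) ^ (\<alpha> + \<beta>)"
          using r(1) by (simp add: power_divide)
        also have "\<dots> \<le> r ^ (\<alpha> + \<beta>) * (norm z / r) ^ m"
          using False r(1) z by (intro mult_left_mono power_decreasing) auto
        finally have "norm (coeff2 f \<alpha> \<beta>) * norm z ^ (\<alpha> + \<beta>) \<le>
            norm (coeff2 f \<alpha> \<beta>) * (r ^ (\<alpha> + \<beta>) * (norm z / r) ^ m)"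
          by (rule mult_left_mono) simp
        with term2_bound[of z "norm z" f \<alpha> \<beta>] show ?thesis by (simp add: p mult.assoc)
      qed
    qed
    then show ?thesis by (simp add: power_divide)
  qed
  with eventually_norm_le_nhds_0[OF r(1)]
  have "\<forall>\<^sub>F z in nhds 0. norm (eval2 f z) \<le> (S / r ^ m) * norm z ^ m"
    by (auto elim: eventually_mono)
  then show ?thesis by (rule that)
qed

text \<open>Removing the part of degree \<open>m\<close> leaves a series of order at least
  \<open>m + 1\<close>.\<close>

lemma eval2_minus_hom_part_bigo:
  assumes "enat m \<le> order2 f"
  obtains C where
    "\<forall>\<^sub>F z in nhds 0. norm (eval2 f z - eval2 (hom_part m f) z) \<le> C * norm z ^ Suc m"
proof -
  define g where "g = f - hom_part m f"
  have "enat (Suc m) \<le> order2 g"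
    using assms by (auto simp: le_order2_iff g_def coeff2_diff coeff2_hom_part)
  then obtain C where C: "\<forall>\<^sub>F z in nhds 0. norm (eval2 g z) \<le> C * norm z ^ Suc m"
    by (rule eval2_bigo)
  have "\<forall>\<^sub>F z in nhds 0. norm (eval2 f z - eval2 (hom_part m f) z) \<le> C * norm z ^ Suc m"
    using C eventually_converges_at[of g]
  proof eventually_elim
    case (elim z)
    have "eval2 f z = eval2 (hom_part m f) z + eval2 g z"
      using eval2_add[OF converges_at_hom_part elim(2), of m f] by (simp add: g_def)
    with elim show ?case by simp
  qed
  then show ?thesis by (rule that)
qed

text \<open>The leading pair has a positive minimum \<open>c\<close> on the unit sphere, hence size
  at least \<open>c * norm z ^ m\<close> by homogeneity; close to the origin the remainders consume
  at most half of this.\<close>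

lemma eval2_pair_lower_bound:
  assumes "enat m \<le> order2 g" "enat m \<le> order2 h"
    and nz: "\<And>z. z \<noteq> 0 \<Longrightarrow> (eval2 (hom_part m g) z, eval2 (hom_part m h) z) \<noteq> 0"
  obtains c where "c > 0" "\<forall>\<^sub>F z in nhds 0. c * norm z ^ m \<le> norm (eval2 g z, eval2 h z)"
proof -
  define F where "F z = (eval2 (hom_part m g) z, eval2 (hom_part m h) z)" for z
  have "(1, 0) \<in> sphere (0 :: complex \<times> complex) 1" by (simp add: norm_Pair)
  then have "sphere (0 :: complex \<times> complex) 1 \<noteq> {}" by blast
  moreover have "continuous_on (sphere 0 1) (\<lambda>z. norm (F z))"
    unfolding F_def by (intro continuous_intros continuous_on_eval2_hom_part)
  ultimately obtain w where w: "w \<in> sphere 0 1" "\<forall>z\<in>sphere 0 1. norm (F w) \<le> norm (F z)"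
    using continuous_attains_inf[OF compact_sphere] by blast
  define c where "c = norm (F w)"
  have "w \<noteq> 0" using w(1) by auto
  then have c: "c > 0" using nz by (simp add: c_def F_def)
  have F_scaleR: "F (t *\<^sub>R z) = t ^ m *\<^sub>R F z" for t z
    by (simp add: F_def eval2_hom_part_scaleR)
  have F: "c * norm z ^ m \<le> norm (F z)" for z
  proof (cases "z = 0")
    case True
    \<comment> \<open>Scaling \<open>w\<close> by 0 also covers \<open>m = 0\<close>, where
      \<open>0 ^ m = 1\<close> and the value at the origin is that at \<open>w\<close>.\<close>
    then show ?thesis using F_scaleR[of 0 w] by (simp add: c_def mult.commute)
  next
    case False
    define u where "u = inverse (norm z) *\<^sub>R z"
    have "u \<in> sphere 0 1" "z = norm z *\<^sub>R u" using False by (auto simp: u_def)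
    then have "norm (F z) = norm z ^ m * norm (F u)"
      using F_scaleR[of "norm z" u] by simp
    moreover have "c \<le> norm (F u)" using w(2) \<open>u \<in> sphere 0 1\<close> by (simp add: c_def)
    ultimately show ?thesis by (simp add: mult.commute mult_right_mono)
  qed
  obtain C where C: "\<forall>\<^sub>F z in nhds 0. norm (eval2 g z - eval2 (hom_part m g) z) \<le> C * norm z ^ Suc m"
    using assms(1) by (rule eval2_minus_hom_part_bigo)
  obtain D where D: "\<forall>\<^sub>F z in nhds 0. norm (eval2 h z - eval2 (hom_part m h) z) \<le> D * norm z ^ Suc m"
    using assms(2) by (rule eval2_minus_hom_part_bigo)
  \<comment> \<open>The constants \<open>C\<close> and \<open>D\<close> may be negative, hence the
    absolute values; the added 1 allows division by \<open>E\<close>. On the radius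
    \<open>c / (2 * E)\<close> the factor \<open>E * norm z\<close> is at most
    \<open>c / 2\<close>.\<close>
  define E where "E = \<bar>C\<bar> + \<bar>D\<bar> + 1"
  have E: "E > 0" by (simp add: E_def add_nonneg_pos)
  have "c / (2 * E) > 0" using c E by simp
  from C D eventually_norm_le_nhds_0[OF this]
  have "\<forall>\<^sub>F z in nhds 0. (c / 2) * norm z ^ m \<le> norm (eval2 g z, eval2 h z)"
  proof eventually_elim
    case (elim z)
    define G where "G = (eval2 g z, eval2 h z)"
    have "norm (G - F z) \<le> C * norm z ^ Suc m + D * norm z ^ Suc m"
      using norm_Pair_le[of "fst (G - F z)" "snd (G - F z)"] elim(1,2) by (simp add: G_def F_def)
    also have "\<dots> \<le> E * norm z ^ Suc m"
      unfolding E_def distrib_right[symmetric] by (intro mult_right_mono) auto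
    also have "\<dots> = (E * norm z) * norm z ^ m" by simp
    also have "\<dots> \<le> (c / 2) * norm z ^ m"
      using elim(3) E by (intro mult_right_mono) (auto simp: field_simps)
    finally have "norm (G - F z) \<le> (c / 2) * norm z ^ m" .
    moreover have "norm (F z) \<le> norm G + norm (G - F z)"
      using norm_triangle_sub[of "F z" G] by (simp add: norm_minus_commute)
    ultimately show ?case using F[of z] by (simp add: G_def)
  qed
  with c show ?thesis by (intro that[of "c / 2"]) auto
qed

lemma grad_upper_bound:
  assumes "enat (Suc m) \<le> order2 f"
  obtains C where "\<forall>\<^sub>F z in nhds 0. norm (grad f z) \<le> C * norm z ^ m"
proof -
  obtain C where C: "\<forall>\<^sub>F z in nhds 0. norm (eval2 (deriv_X f) z) \<le> C * norm z ^ m"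
    using order2_deriv(1)[OF assms] by (rule eval2_bigo)
  obtain D where D: "\<forall>\<^sub>F z in nhds 0. norm (eval2 (deriv_Y f) z) \<le> D * norm z ^ m"
    using order2_deriv(2)[OF assms] by (rule eval2_bigo)
  have "\<forall>\<^sub>F z in nhds 0. norm (grad f z) \<le> (C + D) * norm z ^ m"
    using C D
  proof eventually_elim
    case (elim z)
    then show ?case
      using norm_Pair_le[of "eval2 (deriv_X f) z" "eval2 (deriv_Y f) z"]
      by (simp add: grad_def distrib_right)
  qed
  then show ?thesis by (rule that)
qed

section \<open>From two-sided gradient bounds to the exponent\<close>

text \<open>The lower bound makes \<open>n\<close> admissible. An admissible \<theta> below
  \<open>n\<close>, with constant \<open>d\<close>, would combine with the upper bound to give
  \<open>d \<le> C * norm z powr (n - \<theta>)\<close> at points of \<open>A\<close> arbitrarily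
  close to 0, although the right side tends to 0.\<close>

lemma lojasiewicz_exponent_eqI:
  assumes "c > 0" and lower: "\<forall>\<^sub>F z in nhds 0. c * norm z ^ n \<le> norm (grad f z)"
    and upper: "\<forall>\<^sub>F z in nhds 0. norm (grad f z) \<le> C * norm z ^ n"
    and A: "0 islimpt A"
  shows "lojasiewicz_exponent f A = ereal (real n)"
  unfolding lojasiewicz_exponent_def
proof (rule antisym)
  have "\<forall>\<^sub>F z in nhds 0. z \<in> A \<longrightarrow> norm (grad f z) \<ge> c * norm z powr real n"
    using lower
  proof eventually_elim
    case (elim z)
    \<comment> \<open>At the origin \<open>0 powr real n\<close> is 0 even for \<open>n = 0\<close>,
      so the claim is trivial there.\<close>
    then show ?case by (cases "z = 0") (auto simp: powr_realpow)
  qed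
  with \<open>c > 0\<close> show "Inf {ereal \<theta> |\<theta>. 0 \<le> \<theta> \<and>
      (\<exists>c>0. \<forall>\<^sub>F z in nhds 0. z \<in> A \<longrightarrow> norm (grad f z) \<ge> c * norm z powr \<theta>)} \<le> ereal (real n)"
    by (intro Inf_lower) auto
next
  show "ereal (real n) \<le> Inf {ereal \<theta> |\<theta>. 0 \<le> \<theta> \<and>
      (\<exists>c>0. \<forall>\<^sub>F z in nhds 0. z \<in> A \<longrightarrow> norm (grad f z) \<ge> c * norm z powr \<theta>)}"
  proof (rule Inf_greatest, clarify)
    fix \<theta> d :: real
    assume d: "d > 0" and ev: "\<forall>\<^sub>F z in nhds 0. z \<in> A \<longrightarrow> norm (grad f z) \<ge> d * norm z powr \<theta>"
    have "real n \<le> \<theta>"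
    proof (rule ccontr)
      assume "\<not> real n \<le> \<theta>"
      then have \<theta>: "real n - \<theta> > 0" by simp
      have "((\<lambda>z :: complex \<times> complex. C * norm z powr (real n - \<theta>)) \<longlongrightarrow> C * 0) (at 0)"
        by (intro tendsto_mult tendsto_const tendsto_zero_powrI[OF _ tendsto_const] tendsto_norm_zero)
           (use \<theta> in auto)
      then have small: "\<forall>\<^sub>F z :: complex \<times> complex in at 0. C * norm z powr (real n - \<theta>) < d"
        using d by (auto dest: order_tendstoD)
      \<comment> \<open>The punctured filter supplies \<open>z \<noteq> 0\<close>, so the power of
        \<open>norm z\<close> can be split and cancelled.\<close>
      have "\<forall>\<^sub>F z in at 0. z \<notin> A"
        using small filter_leD[OF at_within_le_nhds ev] filter_leD[OF at_within_le_nhds upper]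
          eventually_neq_at_within[of 0]
      proof eventually_elim
        case (elim z)
        show ?case
        proof
          assume "z \<in> A"
          with elim have "d * norm z powr \<theta> \<le> C * norm z ^ n" by linarith
          also have "norm z ^ n = norm z powr (real n - \<theta>) * norm z powr \<theta>"
            using elim(4) by (simp add: powr_realpow flip: powr_add)
          finally have "d \<le> C * norm z powr (real n - \<theta>)"
            using elim(4) by (simp flip: mult.assoc)
          with elim(1) show False by simp
        qed
      qed
      with A show False by (simp add: islimpt_iff_eventually)
    qed
    then show "ereal (real n) \<le> ereal \<theta>" by simp
  qed
qed

section \<open>Continuity, holomorphy and non-isolated zeros\<close>

text \<open>Weierstrass M-test along the net of finite index sets; the partial sums are polynomials,
  so continuity and holomorphy pass to the limit.\<close>

lemma uniform_limit_eval2: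
  assumes "(\<lambda>(\<alpha>, \<beta>). norm (coeff2 f \<alpha> \<beta>) * r ^ (\<alpha> + \<beta>)) summable_on UNIV"
  shows "uniform_limit (cball 0 r)
    (\<lambda>P z. \<Sum>(\<alpha>, \<beta>)\<in>P. coeff2 f \<alpha> \<beta> * fst z ^ \<alpha> * snd z ^ \<beta>) (eval2 f) (finite_subsets_at_top UNIV)"
  unfolding eval2_def[abs_def]
  by (rule Weierstrass_m_test_general[OF _ assms]) (use term2_bound in \<open>auto split: prod.splits\<close>)

lemma continuous_on_eval2:
  assumes "(\<lambda>(\<alpha>, \<beta>). norm (coeff2 f \<alpha> \<beta>) * r ^ (\<alpha> + \<beta>)) summable_on UNIV"
  shows "continuous_on (cball 0 r) (eval2 f)"
  by (rule uniform_limit_theorem[OF _ uniform_limit_eval2[OF assms]])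
     (auto simp: case_prod_unfold intro!: always_eventually continuous_intros)

lemma holomorphic_on_eval2_snd:
  assumes "(\<lambda>(\<alpha>, \<beta>). norm (coeff2 f \<alpha> \<beta>) * r ^ (\<alpha> + \<beta>)) summable_on UNIV"
    and "\<And>y. norm (y :: complex) \<le> s \<Longrightarrow> norm (x, y) \<le> r"
  shows "(\<lambda>y. eval2 f (x, y)) holomorphic_on ball 0 s"
proof -
  have lim: "uniform_limit (cball 0 s)
      (\<lambda>P y. \<Sum>(\<alpha>, \<beta>)\<in>P. coeff2 f \<alpha> \<beta> * fst (x, y) ^ \<alpha> * snd (x, y) ^ \<beta>)
      (\<lambda>y. eval2 f (x, y)) (finite_subsets_at_top UNIV)"
    by (rule uniform_limit_compose'[OF uniform_limit_eval2[OF assms(1)]]) (use assms(2) in auto)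
  show ?thesis
    by (rule holomorphic_uniform_limit[OF _ lim])
       (auto simp: case_prod_unfold
         intro!: always_eventually continuous_intros holomorphic_intros)
qed

text \<open>
  If the zero at the origin were isolated, the minimum modulus principle on the discs
  \<open>{x} \<times> {y. \<bar>y\<bar> \<le> \<delta>}\<close> with \<open>x \<noteq> 0\<close> would keep \<open>\<bar>f (x, 0)\<bar>\<close> away from \<open>0\<close> as \<open>x\<close> tends to \<open>0\<close>.
\<close>

lemma islimpt_zero_set:
  assumes "coeff2 f 0 0 = 0"
  shows "0 islimpt {z. converges_at f z \<and> eval2 f z = 0}"
proof (rule ccontr)
  assume "\<not> ?thesis"
  then obtain e where e: "e > 0"
    and iso: "\<And>z. converges_at f z \<Longrightarrow> eval2 f z = 0 \<Longrightarrow> norm z < e \<Longrightarrow> z = 0"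
    by (auto simp: islimpt_approachable dist_norm)
  obtain r where r: "r > 0" "(\<lambda>(\<alpha>, \<beta>). norm (coeff2 f \<alpha> \<beta>) * r ^ (\<alpha> + \<beta>)) summable_on UNIV"
    by (rule conv_series_radius)
  \<comment> \<open>With a third, points whose coordinates are bounded by \<delta> have norm at most
    \<open>2 * \<delta>\<close>, which is below both \<open>r\<close> and \<open>e\<close>.\<close>
  define \<delta> where "\<delta> = min r e / 3"
  have \<delta>: "\<delta> > 0" using r e by (simp add: \<delta>_def)
  have small: "norm (x, y) \<le> r" "norm (x, y) < e" if "norm x \<le> \<delta>" "norm y \<le> \<delta>" for x y :: complex
    using norm_Pair_le[of x y] that \<delta> unfolding \<delta>_def by linarith+
  have nz: "eval2 f (x, y) \<noteq> 0" if "norm x \<le> \<delta>" "norm y \<le> \<delta>" "(x, y) \<noteq> 0" for x y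
    using iso converges_at_norm_le[OF r(2)] small that by blast
  have cont: "continuous_on (cball 0 r) (eval2 f)" by (rule continuous_on_eval2[OF r(2)])
  \<comment> \<open>The boundary circles of all the discs form one compact set, which avoids the
    origin because \<delta> is positive; this makes the bound \<open>m\<close> independent of
    \<open>x\<close>.\<close>
  let ?K = "cball (0 :: complex) \<delta> \<times> sphere (0 :: complex) \<delta>"
  have "continuous_on ?K (\<lambda>z. norm (eval2 f z))"
    by (intro continuous_on_norm continuous_on_subset[OF cont]) (auto intro: small)
  moreover have "?K \<noteq> {}" "compact ?K" using \<delta> by (auto intro: compact_Times)
  ultimately obtain w where w: "w \<in> ?K" "\<forall>z\<in>?K. norm (eval2 f w) \<le> norm (eval2 f z)"
    using continuous_attains_inf by metis
  define m where "m = norm (eval2 f w)"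
  have m: "m > 0" using nz[of "fst w" "snd w"] w(1) \<delta> by (auto simp: m_def zero_prod_def)
  have low: "m \<le> norm (eval2 f (x, 0))" if x: "x \<noteq> 0" "norm x \<le> \<delta>" for x
  proof -
    have nzx: "eval2 f (x, y) \<noteq> 0" if "norm y \<le> \<delta>" for y
      using nz[OF x(2) that] x(1) by (simp add: zero_prod_def)
    \<comment> \<open>The minimum modulus principle is obtained as the maximum modulus principle for
      the reciprocal, which is holomorphic since the disc contains no zero.\<close>
    have "norm (inverse (eval2 f (x, 0))) \<le> inverse m"
    proof (rule maximum_modulus_frontier[of "\<lambda>y. inverse (eval2 f (x, y))" "cball 0 \<delta>"])
      show "(\<lambda>y. inverse (eval2 f (x, y))) holomorphic_on interior (cball 0 \<delta>)"
        using nzx x small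
        by (auto intro!: holomorphic_on_inverse holomorphic_on_eval2_snd[OF r(2)])
      show "continuous_on (closure (cball 0 \<delta>)) (\<lambda>y. inverse (eval2 f (x, y)))"
        using nzx x small
        by (auto intro!: continuous_on_inverse continuous_on_compose2[OF cont] continuous_intros)
      show "norm (inverse (eval2 f (x, y))) \<le> inverse m" if "y \<in> frontier (cball 0 \<delta>)" for y
      proof -
        have "m \<le> norm (eval2 f (x, y))" using w(2) x that \<delta> by (simp add: m_def)
        then show ?thesis using m by (simp add: norm_inverse le_imp_inverse_le)
      qed
    qed (use \<delta> in auto)
    then show ?thesis using m nzx[of 0] \<delta> by (simp add: norm_inverse)
  qed
  have "isCont (eval2 f) 0"
    using cont r(1) by (intro continuous_on_interior[of "cball 0 r"]) auto
  then have "((\<lambda>x. norm (eval2 f (x, 0))) \<longlongrightarrow> norm (eval2 f 0)) (at 0)"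
    by (intro tendsto_norm isCont_tendsto_compose[of 0 "eval2 f"])
       (auto intro!: tendsto_eq_intros simp: zero_prod_def)
  then have "((\<lambda>x. norm (eval2 f (x, 0))) \<longlongrightarrow> 0) (at 0)"
    using eval2_origin[of f] assms by simp
  moreover have "\<forall>\<^sub>F x in at 0. m \<le> norm (eval2 f (x, 0))"
    unfolding eventually_at using low \<delta> by (intro exI[of _ \<delta>]) auto
  ultimately have "m \<le> 0" by (intro tendsto_lowerbound) auto
  with m show False by simp
qed

section \<open>Gradients of products of linear forms\<close>

text \<open>Evaluating the product rule at \<open>z\<close> uses the values of the series and of
  both derivatives; convergence of a series at a single point does not carry over to its
  derivatives.\<close>

definition converges1_at :: "conv_series \<Rightarrow> complex \<times> complex \<Rightarrow> bool" where
  "converges1_at f z \<longleftrightarrow>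
     converges_at f z \<and> converges_at (deriv_X f) z \<and> converges_at (deriv_Y f) z"

lemma converges1_at_prod_list:
  "\<forall>g\<in>set gs. converges1_at g z \<Longrightarrow> converges1_at (prod_list gs) z"
proof (induction gs)
  case Nil
  have "converges_at (0 :: conv_series) z" by (simp add: converges_at_def case_prod_unfold)
  \<comment> \<open>The series 1 is its own part of degree 0, by the product formula for the empty
    list.\<close>
  moreover have "converges_at 1 z"
    using converges_at_hom_part[of 0 1 z] hom_part_prod_list[of "[]"] by simp
  ultimately show ?case by (simp add: converges1_at_def)
next
  case (Cons g gs)
  then show ?case
    by (simp add: converges1_at_def deriv_X_mult deriv_Y_mult converges_at_mult converges_at_add)
qed

lemma grad_mult:
  assumes "converges1_at f z" "converges1_at g z"
  shows "fst (grad (f * g) z) = fst (grad f z) * eval2 g z + eval2 f z * fst (grad g z)"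
    and "snd (grad (f * g) z) = snd (grad f z) * eval2 g z + eval2 f z * snd (grad g z)"
  using assms
  by (simp_all add: converges1_at_def grad_def deriv_X_mult deriv_Y_mult eval2_add eval2_mult
      converges_at_mult)

lemma eval2_prod_list:
  "\<forall>g\<in>set gs. converges1_at g z \<Longrightarrow> eval2 (prod_list gs) z = (\<Prod>g\<leftarrow>gs. eval2 g z)"
proof (induction gs)
  case Nil
  show ?case using eval2_hom_part[of 0 1 z] hom_part_prod_list[of "[]"] by (simp add: coeff2_1)
next
  case (Cons g gs)
  with converges1_at_prod_list[of gs z] show ?case by (simp add: converges1_at_def eval2_mult)
qed

text \<open>By the product rule each factor, satisfying Euler's relation in degree 1, contributes
  one copy of the whole product.\<close>

lemma euler_prod_list:
  assumes "\<forall>g\<in>set gs. converges1_at g z \<and>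
    fst z * fst (grad g z) + snd z * snd (grad g z) = eval2 g z"
  shows "fst z * fst (grad (prod_list gs) z) + snd z * snd (grad (prod_list gs) z) =
    of_nat (length gs) * eval2 (prod_list gs) z"
  using assms
proof (induction gs)
  case (Cons g gs)
  let ?P = "prod_list gs"
  have conv: "converges1_at g z" "converges1_at ?P z"
    using Cons.prems by (auto intro: converges1_at_prod_list)
  have "fst z * fst (grad (g * ?P) z) + snd z * snd (grad (g * ?P) z) =
      (fst z * fst (grad g z) + snd z * snd (grad g z)) * eval2 ?P z +
      eval2 g z * (fst z * fst (grad ?P z) + snd z * snd (grad ?P z))"
    by (simp add: grad_mult[OF conv] algebra_simps)
  also have "\<dots> = of_nat (length (g # gs)) * (eval2 g z * eval2 ?P z)"
    using Cons by (simp add: algebra_simps)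
  finally show ?case using conv by (simp add: converges1_at_def eval2_mult)
qed (simp add: grad_def)

text \<open>Exactly one factor vanishes at \<open>z\<close>, so the product rule leaves only its
  gradient times the nonzero values of the others. Expressing pairwise exclusion by
  \<open>sorted_wrt\<close> lets the condition pass to the tail in the induction.\<close>

lemma grad_prod_list_nonzero_of_eval2_zero:
  assumes "\<forall>g\<in>set gs. converges1_at g z \<and> grad g z \<noteq> 0"
    and "sorted_wrt (\<lambda>g h. \<not> (eval2 g z = 0 \<and> eval2 h z = 0)) gs"
    and "eval2 (prod_list gs) z = 0"
  shows "grad (prod_list gs) z \<noteq> 0"
  using assms
proof (induction gs)
  case Nil
  then show ?case using eval2_prod_list[of "[]" z] by simp
next
  case (Cons g gs)
  let ?P = "prod_list gs"
  have conv: "converges1_at g z" "converges1_at ?P z"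
    using Cons.prems by (auto intro: converges1_at_prod_list)
  have prod: "eval2 g z * eval2 ?P z = 0"
    using Cons.prems(3) conv by (simp add: converges1_at_def eval2_mult)
  show ?case
  proof (cases "eval2 g z = 0")
    case True
    then have "eval2 ?P z \<noteq> 0"
      using Cons.prems(1,2) eval2_prod_list[of gs z] by (auto simp: prod_list_zero_iff)
    with True Cons.prems(1) show ?thesis
      by (auto simp: prod_eq_iff grad_mult[OF conv])
  next
    case False
    with prod Cons show ?thesis
      by (auto simp: prod_eq_iff grad_mult[OF conv])
  qed
qed

lemma hom_part_1:
  shows converges1_at_hom_part: "converges1_at (hom_part 1 g) z"
    and grad_hom_part_1: "grad (hom_part 1 g) z = (coeff2 g 1 0, coeff2 g 0 1)"
    and eval2_hom_part_1: "eval2 (hom_part 1 g) z = fst z * coeff2 g 1 0 + snd z * coeff2 g 0 1"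
  by (simp_all add: converges1_at_def converges_at_hom_part hom_part_deriv grad_def eval2_hom_part
      coeff2_deriv_X coeff2_deriv_Y)

text \<open>Off the zero set of the product Euler's relation forbids a zero gradient; on it,
  transversality leaves a single vanishing factor.\<close>

lemma grad_prod_linear_nonzero:
  assumes ord: "\<forall>g\<in>set gs. order2 g = 1" and "gs \<noteq> []" "z \<noteq> 0"
    and transverse: "sorted_wrt transverse gs"
  shows "grad (prod_list (map (hom_part 1) gs)) z \<noteq> 0"
proof -
  let ?hs = "map (hom_part 1) gs"
  have lin: "\<forall>h\<in>set ?hs. converges1_at h z \<and> grad h z \<noteq> 0 \<and>
      fst z * fst (grad h z) + snd z * snd (grad h z) = eval2 h z"
  \<comment> \<open>The remaining case is a linear part with zero gradient; it would force order at
    least 2.\<close>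
  proof (clarsimp simp: hom_part_1[unfolded One_nat_def])
    fix g assume g: "g \<in> set gs" and zero: "(coeff2 g (Suc 0) 0, coeff2 g 0 (Suc 0)) = 0"
    have "coeff2 g 0 0 = 0"
      using coeff2_below_order2[of 1 g 0 0] ord g by (simp add: one_enat_def)
    moreover have "(\<alpha>, \<beta>) \<in> {(0, 0), (Suc 0, 0), (0, Suc 0)}" if "\<alpha> + \<beta> < 2" for \<alpha> \<beta> :: nat
      using that by auto
    ultimately have "enat 2 \<le> order2 g"
      using zero by (fastforce simp: le_order2_iff zero_prod_def)
    with g ord show False by (simp add: one_enat_def)
  qed
  show ?thesis
  proof (cases "eval2 (prod_list ?hs) z = 0")
    case True
    have "sorted_wrt (\<lambda>g h. \<not> (eval2 (hom_part 1 g) z = 0 \<and> eval2 (hom_part 1 h) z = 0)) gs"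
    proof (rule sorted_wrt_mono_rel[OF _ transverse])
      \<comment> \<open>Order 1 identifies the initial forms with the linear parts, so
        transversality speaks about exactly these values.\<close>
      fix g h assume "g \<in> set gs" "h \<in> set gs" "transverse g h"
      moreover from this have "initial_form g = hom_part 1 g" "initial_form h = hom_part 1 h"
        using ord by (simp_all add: initial_form_def one_enat_def)
      ultimately show "\<not> (eval2 (hom_part 1 g) z = 0 \<and> eval2 (hom_part 1 h) z = 0)"
        using \<open>z \<noteq> 0\<close> unfolding transverse_def by metis
    qed
    then show ?thesis
      using lin True by (intro grad_prod_list_nonzero_of_eval2_zero) (auto simp: sorted_wrt_map)
  next
    case False
    \<comment> \<open>The factor \<open>length gs\<close> in Euler's relation is nonzero because the
      list is nonempty.\<close>
    then show ?thesis using euler_prod_list[of ?hs z] lin \<open>gs \<noteq> []\<close> by auto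
  qed
qed

section \<open>Application to an ordinary singularity and its polar curves\<close>

theorem corollary1p7:
  fixes f :: conv_series
  assumes "ordinary_singularity f"
  shows "\<forall>l. regular_parameter l \<longrightarrow>
    lojasiewicz_exponent f UNIV = lojasiewicz_exponent f (polar_curve f l) \<and>
    lojasiewicz_exponent f (polar_curve f l) = ereal_of_enat (order2 f) - 1"
proof -
  obtain gs where f: "f = prod_list gs" and ord: "\<forall>g\<in>set gs. order2 g = 1"
    and trans: "\<forall>i<length gs. \<forall>j<length gs. i \<noteq> j \<longrightarrow> transverse (gs ! i) (gs ! j)"
    and two: "2 \<le> order2 f"
    using assms unfolding ordinary_singularity_def tangential_decomposition_def singularity_def
    by blast
  have coeff_low: "coeff2 f \<alpha> \<beta> = 0" if "\<alpha> + \<beta> < 2" for \<alpha> \<beta>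
    using coeff2_below_order2[of 2 f] two that by (simp add: numeral_eq_enat)
  \<comment> \<open>The empty product 1 has a nonzero constant term, against order at least
    2.\<close>
  have "gs \<noteq> []" using coeff_low[of 0 0] f by (auto simp: coeff2_1)
  then obtain k where k: "length gs = Suc k" by (cases gs) auto
  have "sorted_wrt transverse gs" using trans by (auto simp: sorted_wrt_iff_nth_less)
  then have grad_nz: "grad (hom_part (Suc k) f) z \<noteq> 0" if "z \<noteq> 0" for z
    using grad_prod_linear_nonzero[OF ord \<open>gs \<noteq> []\<close> that] hom_part_prod_list[of gs] ord
    by (simp add: f k)
  have ge: "enat (Suc k) \<le> order2 f" using order2_prod_list[of gs] ord by (simp add: f k)
  \<comment> \<open>A larger order would make the part of degree \<open>Suc k\<close> zero, and with
    it the gradient of that part.\<close>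
  have order: "order2 f = enat (Suc k)"
  proof (rule ccontr)
    assume "order2 f \<noteq> enat (Suc k)"
    with ge have "enat (Suc (Suc k)) \<le> order2 f" by (cases "order2 f") auto
    then have "hom_part (Suc k) f = 0"
      by (intro coeff2_eqI) (auto simp: coeff2_hom_part coeff2_below_order2)
    then show False
      using grad_nz[of "(1, 0)"] by (simp add: grad_def zero_prod_def)
  qed
  obtain c where c: "c > 0"
    "\<forall>\<^sub>F z in nhds 0. c * norm z ^ k \<le> norm (eval2 (deriv_X f) z, eval2 (deriv_Y f) z)"
    using order2_deriv[OF ge] grad_nz unfolding grad_def hom_part_deriv
    by (rule eval2_pair_lower_bound)
  obtain C where C: "\<forall>\<^sub>F z in nhds 0. norm (grad f z) \<le> C * norm z ^ k"
    using ge by (rule grad_upper_bound)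
  have exponent: "lojasiewicz_exponent f A = ereal (real k)" if "0 islimpt A" for A
    using c C that unfolding grad_def[symmetric] by (rule lojasiewicz_exponent_eqI)
  \<comment> \<open>Order at least 2 makes both partial derivatives of \<open>f\<close> vanish at
    the origin, so the polar curve passes through it.\<close>
  have "coeff2 (jacobian l f) 0 0 = 0" for l
    using coeff_low by (simp add: jacobian_def coeff2_diff coeff2_mult coeff2_deriv_X coeff2_deriv_Y)
  then have "0 islimpt polar_curve f l" for l
    unfolding polar_curve_def by (rule islimpt_zero_set)
  then show ?thesis
    using exponent order by (simp add: islimpt_UNIV one_ereal_def)
qed

end
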